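(* Let $r$ be a positive integer. For every coloring $c:\mathbf{N}\to\{0,\dots,r-1\}$ there exist an infinite apart set $X$ of positive integers and positive integers $a,b$ such that all elements of $FS^{\{a,\,b,\,a+b\}}(X)$ have the same color under $c$.
   Context: $\mathbf{N}$ is the set of natural numbers. For a positive integer $n=2^{t_1}+\dots+2^{t_k}$ with $t_1<\dots<t_k$ let $\lambda(n)=t_1$ and $\mu(n)=t_k$. A set $X$ of positive integers is apart (satisfies the Apartness Condition) if for all $x,x'\in X$ with $x<x'$ we have $\mu(x)<\lambda(x')$. For a set $A$ of positive integers and a set $B\subseteq\mathbf{N}$, $FS^{A}(B)$ denotes the set of all sums of exactly $j$ distinct elements of $B$, for all $j\in A$. *)

theory Defs
  imports Main
begin

definition bin_exps :: "nat \<Rightarrow> nat set" where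
  "bin_exps n = {t. bit n t}"

text \<open>The least and the greatest exponent in the binary expansion; used for positive
  arguments only, since \<open>bin_exps 0\<close> is empty.\<close>

definition lam :: "nat \<Rightarrow> nat" where
  "lam n = Min (bin_exps n)"

definition mu :: "nat \<Rightarrow> nat" where
  "mu n = Max (bin_exps n)"

definition apart :: "nat set \<Rightarrow> bool" where
  "apart X \<longleftrightarrow> 0 \<notin> X \<and> (\<forall>x\<in>X. \<forall>x'\<in>X. x < x' \<longrightarrow> mu x < lam x')"

definition FS :: "nat set \<Rightarrow> nat set \<Rightarrow> nat set" where
  "FS A B = {\<Sum>F | F. F \<subseteq> B \<and> finite F \<and> card F \<in> A}"

lemma bin_exps_subset: "bin_exps n \<subseteq> {..<n}"
proof
  fix t assume "t \<in> bin_exps n"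
  then have "odd (n div 2 ^ t)"
    by (simp add: bin_exps_def bit_iff_odd)
  then have "n div 2 ^ t \<noteq> 0"
    by (metis even_zero)
  then have "2 ^ t \<le> n"
    by (meson div_less not_le)
  then show "t \<in> {..<n}"
    using less_le_trans[OF less_exp] by blast
qed

lemma finite_bin_exps: "finite (bin_exps n)"
  using bin_exps_subset finite_subset by blast

lemma sum_bin_exps: "(\<Sum>t\<in>bin_exps n. 2 ^ t) = n"
proof -
  have "n = take_bit n n"
    by (simp add: take_bit_nat_eq_self)
  also have "\<dots> = (\<Sum>t = 0..<n. push_bit t (of_bool (bit n t)))"
    by (rule take_bit_sum)
  also have "\<dots> = (\<Sum>t\<in>bin_exps n. 2 ^ t)"
    using bin_exps_subset[of n]
    by (intro sum.mono_neutral_cong_right) (auto simp: bin_exps_def push_bit_eq_mult)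
  finally show ?thesis by simp
qed

end

(* Ramsey's theorem, applied successively to the sums of exactly j elements for j = 1, ..., N,
   yields an infinite set of powers of two on which the color of such a sum depends only on j.
   This induces a coloring of {1, ..., N}, and for N large enough Schur's theorem gives
   a, b and a + b of the same induced color. *)

theory Submission
  imports Defs "HOL-Library.Ramsey"
begin

text \<open>Color an edge \<open>{u, v}\<close> with \<open>u < v\<close> by
  \<open>d (v - u)\<close>. In a monochromatic triangle \<open>x < y < z\<close> the differences
  \<open>y - x\<close> and \<open>z - y\<close> add up to \<open>z - x\<close>.\<close>

theorem schur:
  fixes r :: nat
  shows "\<exists>N. \<forall>d :: nat \<Rightarrow> nat. (\<forall>j. d j < r) \<longrightarrow>
    (\<exists>a b. 0 < a \<and> 0 < b \<and> a + b \<le> N \<and> d a = d b \<and> d b = d (a + b))"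
proof -
  \<comment> \<open>\<open>N\<close> is a Ramsey number for triangles in \<open>r\<close> colors, so
    it depends on \<open>r\<close> alone.\<close>
  obtain N :: nat where N: "partn_lst {..<N} (replicate r 3) 2"
    using ramsey_full by blast
  have "\<exists>a b. 0 < a \<and> 0 < b \<and> a + b \<le> N \<and> d a = d b \<and> d b = d (a + b)"
    if d: "\<forall>j. d j < r" for d :: "nat \<Rightarrow> nat"
  proof -
    define f where "f E = d (Max E - Min E)" for E
    have "f \<in> nsets {..<N} 2 \<rightarrow> {..<r}"
      using d by (simp add: f_def)
    then obtain i H where i: "i < length (replicate r (3::nat))"
      and "H \<in> nsets {..<N} (replicate r 3 ! i)" and f: "f ` nsets H 2 \<subseteq> {i}"
      by (rule partn_lstE[OF N]) simp
    then have "H \<in> nsets {..<N} 3"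
      by simp
    then obtain x y z where H: "H = {x, y, z}" and xyz: "x < y" "y < z" "z < N"
      by (auto simp: ordered_nsets_3_eq)
    have *: "d (v - u) = i" if "u \<in> H" "v \<in> H" "u < v" for u v
    proof -
      have "f {u, v} = i"
        using f that by (auto simp: image_subset_iff)
      then show ?thesis
        using that by (simp add: f_def)
    qed
    have "d (y - x) = i" "d (z - y) = i" "d (z - x) = i"
      using * H xyz by auto
    moreover have "(y - x) + (z - y) = z - x"
      using xyz by simp
    ultimately show ?thesis
      using xyz by (intro exI[of _ "y - x"] exI[of _ "z - y"]) auto
  qed
  then show ?thesis
    by blast
qed

text \<open>Each round thins the set by Ramsey's theorem for one more cardinality; what was achieved
  for smaller cardinalities passes to subsets.\<close>

lemma Ramsey_upto:
  fixes f :: "'a set \<Rightarrow> nat"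
  assumes "infinite Z" and "\<And>F. f F < r"
  shows "\<exists>Y d. Y \<subseteq> Z \<and> infinite Y \<and> (\<forall>j. d j < r) \<and>
    (\<forall>F. F \<subseteq> Y \<and> finite F \<and> card F \<le> N \<longrightarrow> f F = d (card F))"
proof (induction N)
  case 0
  \<comment> \<open>Only the empty set matters here; the constant \<open>f {}\<close> keeps
    \<open>d\<close> below \<open>r\<close> at every argument, as \<open>schur\<close>
    demands.\<close>
  show ?case
    using assms by (intro exI[of _ Z] exI[of _ "\<lambda>_. f {}"]) auto
next
  case (Suc N)
  then obtain Y d where Y: "Y \<subseteq> Z" "infinite Y" and d: "\<forall>j. d j < r"
    and IH: "\<forall>F. F \<subseteq> Y \<and> finite F \<and> card F \<le> N \<longrightarrow> f F = d (card F)"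
    by blast
  obtain Y' t where Y': "Y' \<subseteq> Y" "infinite Y'" and t: "t < r"
    and mono: "\<forall>F. F \<subseteq> Y' \<and> finite F \<and> card F = Suc N \<longrightarrow> f F = t"
    using Ramsey[OF Y(2), of "Suc N" f r] assms(2) by blast
  have "f F = (d(Suc N := t)) (card F)" if "F \<subseteq> Y'" "finite F" "card F \<le> Suc N" for F
    using that IH mono Y' by (auto simp: le_Suc_eq)
  then show ?case
    using Y Y' d t by (intro exI[of _ Y'] exI[of _ "d(Suc N := t)"]) auto
qed

lemma bin_exps_power2: "bin_exps (2 ^ i) = {i}"
  by (auto simp: bin_exps_def bit_exp_iff)

text \<open>A power of two has a single binary exponent, so \<open>lam\<close> and \<open>mu\<close>
  agree on it and grow with it.\<close>

lemma apart_powers_of_two: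
  assumes "X \<subseteq> range (\<lambda>i. 2 ^ i)"
  shows "apart X"
  unfolding apart_def
proof (intro conjI ballI impI)
  show "0 \<notin> X"
    using assms by auto
  fix x x' assume "x \<in> X" "x' \<in> X" "x < x'"
  moreover obtain i j where "x = 2 ^ i" "x' = 2 ^ j"
    using assms \<open>x \<in> X\<close> \<open>x' \<in> X\<close> by blast
  ultimately show "mu x < lam x'"
    by (simp add: lam_def mu_def bin_exps_power2)
qed

theorem mainTheorem6:
  fixes r :: nat and c :: "nat \<Rightarrow> nat"
  assumes "r > 0"
    and "\<And>n. c n < r"
  shows "\<exists>X a b. infinite X \<and> apart X \<and> a > 0 \<and> b > 0 \<and>
    (\<exists>k. \<forall>s\<in>FS {a, b, a + b} X. c s = k)"
proof -
  \<comment> \<open>The bound is uniform in \<open>d\<close>, so it can be fixed before the set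
    \<open>X\<close> that determines \<open>d\<close>.\<close>
  obtain N where N: "\<forall>d :: nat \<Rightarrow> nat. (\<forall>j. d j < r) \<longrightarrow>
    (\<exists>a b. 0 < a \<and> 0 < b \<and> a + b \<le> N \<and> d a = d b \<and> d b = d (a + b))"
    using schur[of r] ..
  have inf: "infinite (range (\<lambda>i. 2 ^ i :: nat))"
    by (intro range_inj_infinite injI) simp
  obtain X d where X: "X \<subseteq> range (\<lambda>i. 2 ^ i :: nat)" "infinite X" and d: "\<forall>j. d j < r"
    and col: "\<forall>F. F \<subseteq> X \<and> finite F \<and> card F \<le> N \<longrightarrow> c (\<Sum>F) = d (card F)"
    using Ramsey_upto[OF inf, of "\<lambda>F. c (\<Sum>F)" r N] assms(2) by blast
  obtain a b where ab: "0 < a" "0 < b" "a + b \<le> N" "d a = d b" "d b = d (a + b)"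
    using N d by blast
  \<comment> \<open>All three cardinalities are at most \<open>N\<close>, hence within reach of
    \<open>col\<close>.\<close>
  have "c s = d a" if "s \<in> FS {a, b, a + b} X" for s
    using that ab col by (auto simp: FS_def)
  then show ?thesis
    using X ab apart_powers_of_two by blast
qed

end
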